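(* Let $A$, $B$, $C$ be finite (universal) algebras with $A\le C$. (i) If $B'\cong B$ and $C'\cong C$, then $\mathcal H_C(B)=\mathcal H_{C'}(B')$. (ii) If $A'\in O_A$ and $B'\cong B$, then $\mathcal H_C(A|B)=\mathcal H_C(A'|B')$. (iii) If $A'\in O_A$, $B\le C$ and $B'\in O_B$, then $\mathcal H_C^*(A|B)=\mathcal H_C^*(A'|B')$.
   Context: All algebras are finite universal algebras (of a common type). For $X\le C$, $O_X$ denotes the orbit of $X$ under the natural action of $\mathrm{Aut}(C)$ on the set of subalgebras of $C$ isomorphic to $X$. For algebras $A,B,C$ define (Hasse constants): $\mathcal H_C(B)=|\{B_0\le C:\ B_0\cong B\}|$; for $A\le C$, $\mathcal H_C(A|B)=|\{B_0\le C:\ A\le B_0\cong B\}|$; for $A,B\le C$, $\mathcal H_C^*(A|B)=|\{B_0\le C:\ A\le B_0,\ B_0\in O_B\}|$. *)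

theory Defs
  imports "HOL-Algebra.Group_Action"
begin

text \<open>
  A type of algebras is a type of operation symbols together with an arity function
  \<open>ar\<close>. Operations are required to be extensional, i.e. \<open>undefined\<close> off the argument
  lists over the carrier, so that equality of records is equality of algebras
  and sets of algebras have the right cardinality.
  As in parts of the literature, the empty carrier is not excluded; for nonempty \<open>A\<close> and \<open>B\<close>
  this has no influence on the numbers defined below.
\<close>

record ('f, 'a) ualg = "'a partial_object" +
  oper :: "'f \<Rightarrow> 'a list \<Rightarrow> 'a"

definition args :: "('f \<Rightarrow> nat) \<Rightarrow> 'a set \<Rightarrow> 'f \<Rightarrow> 'a list set" where
  "args ar S f = {xs \<in> lists S. length xs = ar f}"

definition ualgebra :: "('f \<Rightarrow> nat) \<Rightarrow> ('f, 'a) ualg \<Rightarrow> bool" where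
  "ualgebra ar A \<longleftrightarrow> (\<forall>f. oper A f \<in> args ar (carrier A) f \<rightarrow>\<^sub>E carrier A)"

definition finite_ualgebra :: "('f \<Rightarrow> nat) \<Rightarrow> ('f, 'a) ualg \<Rightarrow> bool" where
  "finite_ualgebra ar A \<longleftrightarrow> ualgebra ar A \<and> finite (carrier A)"

definition subalg :: "('f \<Rightarrow> nat) \<Rightarrow> ('f, 'a) ualg \<Rightarrow> ('f, 'a) ualg \<Rightarrow> bool" where
  "subalg ar A C \<longleftrightarrow> ualgebra ar A \<and> ualgebra ar C \<and> carrier A \<subseteq> carrier C \<and>
     (\<forall>f. \<forall>xs \<in> args ar (carrier A) f. oper A f xs = oper C f xs)"

definition ualg_hom :: "('f \<Rightarrow> nat) \<Rightarrow> ('f, 'a) ualg \<Rightarrow> ('f, 'b) ualg \<Rightarrow> ('a \<Rightarrow> 'b) set" where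
  "ualg_hom ar A B = {h \<in> carrier A \<rightarrow> carrier B.
     \<forall>f. \<forall>xs \<in> args ar (carrier A) f. h (oper A f xs) = oper B f (map h xs)}"

definition ualg_isomorphic :: "('f \<Rightarrow> nat) \<Rightarrow> ('f, 'a) ualg \<Rightarrow> ('f, 'b) ualg \<Rightarrow> bool" where
  "ualg_isomorphic ar A B \<longleftrightarrow> (\<exists>h \<in> ualg_hom ar A B. bij_betw h (carrier A) (carrier B))"

definition Aut :: "('f \<Rightarrow> nat) \<Rightarrow> ('f, 'a) ualg \<Rightarrow> ('a \<Rightarrow> 'a) monoid" where
  "Aut ar C = BijGroup (carrier C) \<lparr>carrier := ualg_hom ar C C \<inter> Bij (carrier C)\<rparr>"

definition induced_alg :: "('f \<Rightarrow> nat) \<Rightarrow> ('f, 'a) ualg \<Rightarrow> 'a set \<Rightarrow> ('f, 'a) ualg" where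
  "induced_alg ar C S = \<lparr>carrier = S, oper = (\<lambda>f. restrict (oper C f) (args ar S f))\<rparr>"

definition iso_subalgs :: "('f \<Rightarrow> nat) \<Rightarrow> ('f, 'a) ualg \<Rightarrow> ('f, 'b) ualg \<Rightarrow> ('f, 'a) ualg set" where
  "iso_subalgs ar C X = {Y. subalg ar Y C \<and> ualg_isomorphic ar Y X}"

definition Aut_action ::
  "('f \<Rightarrow> nat) \<Rightarrow> ('f, 'a) ualg \<Rightarrow> ('f, 'b) ualg \<Rightarrow> ('a \<Rightarrow> 'a) \<Rightarrow> ('f, 'a) ualg \<Rightarrow> ('f, 'a) ualg" where
  "Aut_action ar C X h = (\<lambda>Y \<in> iso_subalgs ar C X. induced_alg ar C (h ` carrier Y))"

definition Aut_orbit :: "('f \<Rightarrow> nat) \<Rightarrow> ('f, 'a) ualg \<Rightarrow> ('f, 'a) ualg \<Rightarrow> ('f, 'a) ualg set" where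
  "Aut_orbit ar C X = orbit (Aut ar C) (Aut_action ar C X) X"

text \<open>
  \<open>hasse\<close>, \<open>hasse_over\<close> and \<open>hasse_orbit\<close> are the Hasse constants written
  $\mathcal H_C(B)$, $\mathcal H_C(A|B)$ and $\mathcal H_C^*(A|B)$.
\<close>

definition hasse :: "('f \<Rightarrow> nat) \<Rightarrow> ('f, 'a) ualg \<Rightarrow> ('f, 'b) ualg \<Rightarrow> nat" where
  "hasse ar C B = card {B\<^sub>0. subalg ar B\<^sub>0 C \<and> ualg_isomorphic ar B\<^sub>0 B}"

definition hasse_over ::
  "('f \<Rightarrow> nat) \<Rightarrow> ('f, 'a) ualg \<Rightarrow> ('f, 'a) ualg \<Rightarrow> ('f, 'b) ualg \<Rightarrow> nat" where
  "hasse_over ar C A B =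
     card {B\<^sub>0. subalg ar B\<^sub>0 C \<and> subalg ar A B\<^sub>0 \<and> ualg_isomorphic ar B\<^sub>0 B}"

definition hasse_orbit ::
  "('f \<Rightarrow> nat) \<Rightarrow> ('f, 'a) ualg \<Rightarrow> ('f, 'a) ualg \<Rightarrow> ('f, 'a) ualg \<Rightarrow> nat" where
  "hasse_orbit ar C A B =
     card {B\<^sub>0. subalg ar B\<^sub>0 C \<and> subalg ar A B\<^sub>0 \<and> B\<^sub>0 \<in> Aut_orbit ar C B}"

text \<open>
  The remaining lemmas confirm that \<open>Aut_action\<close> is a group action in the sense of the library.
\<close>

lemma args_map: "h ` S \<subseteq> T \<Longrightarrow> xs \<in> args ar S f \<Longrightarrow> map h xs \<in> args ar T f"
  by (force simp: args_def)

lemma args_image: "xs \<in> args ar (h ` S) f \<Longrightarrow> \<exists>ys \<in> args ar S f. xs = map h ys"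
  by (auto simp: args_def lists_image)

lemma ualgebra_closed: "ualgebra ar A \<Longrightarrow> xs \<in> args ar (carrier A) f \<Longrightarrow> oper A f xs \<in> carrier A"
  by (auto simp: ualgebra_def PiE_def)

lemma subalg_induced: "subalg ar Y C \<longleftrightarrow>
  ualgebra ar Y \<and> ualgebra ar C \<and> carrier Y \<subseteq> carrier C \<and> Y = induced_alg ar C (carrier Y)"
proof -
  have "(\<forall>f. \<forall>xs \<in> args ar (carrier Y) f. oper Y f xs = oper C f xs) \<longleftrightarrow>
        Y = induced_alg ar C (carrier Y)" if "ualgebra ar Y"
  proof
    assume *: "\<forall>f. \<forall>xs \<in> args ar (carrier Y) f. oper Y f xs = oper C f xs"
    have "oper Y f = restrict (oper C f) (args ar (carrier Y) f)" for f
    proof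
      fix xs
      show "oper Y f xs = restrict (oper C f) (args ar (carrier Y) f) xs"
        using that * by (cases "xs \<in> args ar (carrier Y) f")
          (auto simp: ualgebra_def PiE_def extensional_def)
    qed
    then show "Y = induced_alg ar C (carrier Y)"
      by (cases Y) (simp add: induced_alg_def fun_eq_iff)
  next
    assume *: "Y = induced_alg ar C (carrier Y)"
    have "oper Y f = oper (induced_alg ar C (carrier Y)) f" for f
      using * by metis
    then show "\<forall>f. \<forall>xs \<in> args ar (carrier Y) f. oper Y f xs = oper C f xs"
      by (simp add: induced_alg_def)
  qed
  then show ?thesis by (auto simp: subalg_def)
qed

lemma ualg_isomorphic_inv_hom:
  assumes "ualgebra ar A" "h \<in> ualg_hom ar A B" "bij_betw h (carrier A) (carrier B)"
  shows "restrict (inv_into (carrier A) h) (carrier B) \<in> ualg_hom ar B A"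
    (is "?g \<in> _")
proof -
  have im: "h ` carrier A = carrier B" and inj: "inj_on h (carrier A)"
    using assms(3) by (auto simp: bij_betw_def)
  have gh: "?g (h x) = x" if "x \<in> carrier A" for x
    using that im inj by (auto simp: inv_into_f_f)
  have "?g (oper B f xs) = oper A f (map ?g xs)" if xs: "xs \<in> args ar (carrier B) f" for f xs
  proof -
    obtain ys where ys: "ys \<in> args ar (carrier A) f" "xs = map h ys"
      using args_image[of xs ar h "carrier A" f] xs unfolding im by blast
    have "map ?g xs = ys"
      unfolding ys(2) map_map
      by (rule map_idI, unfold o_apply, rule gh) (use ys(1) in \<open>auto simp: args_def\<close>)
    moreover have "oper B f xs = h (oper A f ys)"
      using ys assms(2) by (auto simp: ualg_hom_def)
    ultimately show ?thesis using gh ualgebra_closed[OF assms(1) ys(1)] by simp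
  qed
  moreover have "?g \<in> carrier B \<rightarrow> carrier A"
    using im by (auto intro: inv_into_into)
  ultimately show ?thesis by (simp add: ualg_hom_def)
qed

lemma ualg_hom_comp:
  assumes "ualgebra ar A" "h \<in> ualg_hom ar A B" "g \<in> ualg_hom ar B D"
  shows "compose (carrier A) g h \<in> ualg_hom ar A D"
proof -
  have hm: "map h xs \<in> args ar (carrier B) f" if "xs \<in> args ar (carrier A) f" for xs f
    using that assms(2) by (intro args_map[of h "carrier A"]) (auto simp: ualg_hom_def)
  have "map (compose (carrier A) g h) xs = map g (map h xs)"
    if "xs \<in> args ar (carrier A) f" for xs f
    using that by (auto simp: args_def compose_def)
  then show ?thesis
    using assms hm ualgebra_closed[OF assms(1)]
    by (auto simp: ualg_hom_def compose_eq Pi_iff simp del: map_map)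
qed

lemma subgroup_Aut:
  assumes "ualgebra ar C"
  shows "subgroup (ualg_hom ar C C \<inter> Bij (carrier C)) (BijGroup (carrier C))"
proof (rule subgroup.intro)
  show "ualg_hom ar C C \<inter> Bij (carrier C) \<subseteq> carrier (BijGroup (carrier C))"
    by (simp add: BijGroup_def)
next
  fix x y
  assume "x \<in> ualg_hom ar C C \<inter> Bij (carrier C)" "y \<in> ualg_hom ar C C \<inter> Bij (carrier C)"
  then show "x \<otimes>\<^bsub>BijGroup (carrier C)\<^esub> y \<in> ualg_hom ar C C \<inter> Bij (carrier C)"
    using ualg_hom_comp[OF assms] by (auto simp: BijGroup_def compose_Bij)
next
  have "map (restrict (\<lambda>x. x) (carrier C)) xs = xs" if "xs \<in> args ar (carrier C) f" for xs f
    by (rule map_idI) (use that in \<open>auto simp: args_def\<close>)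
  then show "\<one>\<^bsub>BijGroup (carrier C)\<^esub> \<in> ualg_hom ar C C \<inter> Bij (carrier C)"
    using ualgebra_closed[OF assms] by (auto simp: BijGroup_def id_Bij ualg_hom_def)
next
  fix x assume "x \<in> ualg_hom ar C C \<inter> Bij (carrier C)"
  then show "inv\<^bsub>BijGroup (carrier C)\<^esub> x \<in> ualg_hom ar C C \<inter> Bij (carrier C)"
    using ualg_isomorphic_inv_hom[OF assms, of x C] restrict_inv_into_Bij[of x "carrier C"]
    by (simp add: inv_BijGroup Bij_def)
qed

lemma group_Aut: "ualgebra ar C \<Longrightarrow> group (Aut ar C)"
  unfolding Aut_def by (intro subgroup.subgroup_is_group subgroup_Aut group_BijGroup)

lemma induced_alg_image:
  assumes C: "ualgebra ar C" and h: "h \<in> carrier (Aut ar C)" and Y: "Y \<in> iso_subalgs ar C X"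
  shows "induced_alg ar C (h ` carrier Y) \<in> iso_subalgs ar C X"
proof -
  have hh: "h \<in> ualg_hom ar C C" and hb: "bij_betw h (carrier C) (carrier C)"
    using h by (auto simp: Aut_def Bij_def)
  have sY: "subalg ar Y C" and iY: "ualg_isomorphic ar Y X"
    using Y by (auto simp: iso_subalgs_def)
  have Yalg: "ualgebra ar Y" and YC: "carrier Y \<subseteq> carrier C"
    using sY by (auto simp: subalg_def)
  let ?Z = "induced_alg ar C (h ` carrier Y)"
  have op: "oper C f (map h ys) = h (oper Y f ys)" if "ys \<in> args ar (carrier Y) f" for f ys
  proof -
    have "ys \<in> args ar (carrier C) f" using that YC by (auto simp: args_def)
    then show ?thesis using that hh sY by (auto simp: ualg_hom_def subalg_def)
  qed
  have Zalg: "ualgebra ar ?Z"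
    unfolding ualgebra_def
  proof (intro allI PiE_I)
    fix f xs assume xs: "xs \<in> args ar (carrier ?Z) f"
    then obtain ys where "ys \<in> args ar (carrier Y) f" "xs = map h ys"
      using args_image[of xs ar h "carrier Y" f] by (auto simp: induced_alg_def)
    then show "oper ?Z f xs \<in> carrier ?Z"
      using op xs ualgebra_closed[OF Yalg] by (auto simp: induced_alg_def)
  qed (auto simp: induced_alg_def)
  have "h ` carrier Y \<subseteq> carrier C" using hb YC by (auto simp: bij_betw_def)
  then have sZ: "subalg ar ?Z C"
    using Zalg C by (simp add: subalg_induced) (simp add: induced_alg_def)
  have hYZ: "h \<in> ualg_hom ar Y ?Z"
    using op by (auto simp: args_map[OF order_refl] ualg_hom_def induced_alg_def)
  have bYZ: "bij_betw h (carrier Y) (carrier ?Z)"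
    using hb YC by (auto simp: bij_betw_def induced_alg_def intro: inj_on_subset)
  obtain k where k: "k \<in> ualg_hom ar Y X" "bij_betw k (carrier Y) (carrier X)"
    using iY by (auto simp: ualg_isomorphic_def)
  have gb: "bij_betw (restrict (inv_into (carrier Y) h) (carrier ?Z)) (carrier ?Z) (carrier Y)"
    using bij_betw_inv_into[OF bYZ] by simp
  have "ualg_isomorphic ar ?Z X"
    unfolding ualg_isomorphic_def
    using ualg_hom_comp[OF Zalg ualg_isomorphic_inv_hom[OF Yalg hYZ bYZ] k(1)]
      bij_betw_compose[OF gb k(2)] by blast
  then show ?thesis using sZ by (simp add: iso_subalgs_def)
qed

lemma Aut_action_mult:
  assumes C: "ualgebra ar C" and "g \<in> carrier (Aut ar C)" "h \<in> carrier (Aut ar C)"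
  shows "Aut_action ar C X (g \<otimes>\<^bsub>Aut ar C\<^esub> h)
    = compose (iso_subalgs ar C X) (Aut_action ar C X g) (Aut_action ar C X h)"
proof
  fix Y
  show "Aut_action ar C X (g \<otimes>\<^bsub>Aut ar C\<^esub> h) Y
    = compose (iso_subalgs ar C X) (Aut_action ar C X g) (Aut_action ar C X h) Y"
  proof (cases "Y \<in> iso_subalgs ar C X")
    case True
    then have "carrier Y \<subseteq> carrier C" by (auto simp: iso_subalgs_def subalg_def)
    then have "(g \<otimes>\<^bsub>Aut ar C\<^esub> h) ` carrier Y = g ` h ` carrier Y"
      using assms by (force simp: Aut_def BijGroup_def compose_def image_iff)
    then show ?thesis
      using True induced_alg_image[OF C assms(3) True]
      by (simp add: Aut_action_def compose_def) (simp add: induced_alg_def)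
  qed (simp add: Aut_action_def compose_def)
qed

lemma Aut_action_one:
  assumes C: "ualgebra ar C"
  shows "Aut_action ar C X \<one>\<^bsub>Aut ar C\<^esub> = (\<lambda>Y \<in> iso_subalgs ar C X. Y)"
proof
  fix Y
  show "Aut_action ar C X \<one>\<^bsub>Aut ar C\<^esub> Y = (\<lambda>Y \<in> iso_subalgs ar C X. Y) Y"
  proof (cases "Y \<in> iso_subalgs ar C X")
    case True
    then have YC: "carrier Y \<subseteq> carrier C" and Y: "Y = induced_alg ar C (carrier Y)"
      by (auto simp: iso_subalgs_def subalg_induced)
    have "\<one>\<^bsub>Aut ar C\<^esub> ` carrier Y = carrier Y"
      using YC by (force simp: Aut_def BijGroup_def image_iff)
    then show ?thesis using True Y by (simp add: Aut_action_def)
  qed (simp add: Aut_action_def)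
qed

lemma Aut_action_Bij:
  assumes C: "ualgebra ar C" and g: "g \<in> carrier (Aut ar C)"
  shows "Aut_action ar C X g \<in> Bij (iso_subalgs ar C X)"
proof -
  interpret group "Aut ar C" using C by (rule group_Aut)
  let ?E = "iso_subalgs ar C X" and ?a = "Aut_action ar C X"
  have maps: "?a h \<in> ?E \<rightarrow> ?E" if "h \<in> carrier (Aut ar C)" for h
    using induced_alg_image[OF C that] by (auto simp: Aut_action_def)
  have i: "inv\<^bsub>Aut ar C\<^esub> g \<in> carrier (Aut ar C)" using g by simp
  have inv: "?a k (?a h Y) = Y" if "h \<in> carrier (Aut ar C)" "k \<in> carrier (Aut ar C)"
    "k \<otimes>\<^bsub>Aut ar C\<^esub> h = \<one>\<^bsub>Aut ar C\<^esub>" "Y \<in> ?E" for h k Y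
    using fun_cong[OF Aut_action_mult[OF C that(2,1), of X], of Y]
      fun_cong[OF Aut_action_one[OF C, of X], of Y] that by (simp add: compose_eq)
  have "bij_betw (?a g) ?E ?E"
    by (rule bij_betw_byWitness[where f' = "?a (inv\<^bsub>Aut ar C\<^esub> g)"])
      (use inv[OF g i] inv[OF i g] maps[OF g] maps[OF i] g in auto)
  then show ?thesis by (simp add: Bij_def Aut_action_def)
qed

lemma group_action_Aut:
  assumes C: "ualgebra ar C"
  shows "group_action (Aut ar C) (iso_subalgs ar C X) (Aut_action ar C X)"
  unfolding group_action_def group_hom_def group_hom_axioms_def
  using group_Aut[OF C] group_BijGroup Aut_action_Bij[OF C] Aut_action_mult[OF C]
  by (auto simp: hom_def) (auto simp: BijGroup_def)

end

theory Submission
  imports Defs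
begin

text \<open>
  All three equalities hold because an isomorphism \<open>h\<close> from \<open>C\<close> to \<open>C'\<close> carries the whole
  structure of the subalgebras of \<open>C\<close> over to those of \<open>C'\<close>. The map \<open>Y \<mapsto> h(Y)\<close>, written
  \<open>image_alg ar C' h Y\<close>, is a bijection between the two sets of subalgebras
  (\<open>bij_betw_image_alg\<close>); it maps each \<open>Y\<close> to an isomorphic copy of itself, and it preserves and
  reflects inclusion. Therefore it matches any property of subalgebras that is phrased in terms of
  isomorphism types and inclusions with the corresponding property in \<open>C'\<close>, and the
  two properties hold for equally many subalgebras (\<open>card_subalgs_transport\<close>).

  For the first claim, \<open>h\<close> is an isomorphism between the two ambient algebras. For the other two,
  \<open>A'\<close> is by hypothesis the image \<open>h(A)\<close> under some automorphism \<open>h\<close> of \<open>C\<close>, and this \<open>h\<close> is used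
  as an isomorphism from \<open>C\<close> to itself. An automorphism moves each subalgebra within its orbit, and
  \<open>D' \<in> O\<^sub>D\<close> forces \<open>O\<^sub>D = O\<^sub>D\<^sub>'\<close>, so that membership in the orbit is also preserved.
\<close>

section \<open>Isomorphism of algebras\<close>

definition ualg_iso :: "('f \<Rightarrow> nat) \<Rightarrow> ('f, 'a) ualg \<Rightarrow> ('f, 'b) ualg \<Rightarrow> ('a \<Rightarrow> 'b) set" where
  "ualg_iso ar A B = {h \<in> ualg_hom ar A B. bij_betw h (carrier A) (carrier B)}"

lemma ualg_isomorphic_iff_ualg_iso: "ualg_isomorphic ar A B \<longleftrightarrow> (\<exists>h. h \<in> ualg_iso ar A B)"
  by (auto simp: ualg_isomorphic_def ualg_iso_def)

lemma inv_ualg_iso: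
  assumes "ualgebra ar A" "h \<in> ualg_iso ar A B"
  shows "restrict (inv_into (carrier A) h) (carrier B) \<in> ualg_iso ar B A"
  using assms ualg_isomorphic_inv_hom[of ar A h B] bij_betw_inv_into[of h "carrier A" "carrier B"]
  by (simp add: ualg_iso_def)

lemma ualg_isomorphic_refl: "ualg_isomorphic ar A A"
proof -
  have "map (\<lambda>x. x) xs = xs" for xs :: "'b list" by simp
  then have "(\<lambda>x. x) \<in> ualg_iso ar A A"
    by (auto simp: ualg_iso_def ualg_hom_def bij_betw_def)
  then show ?thesis by (auto simp: ualg_isomorphic_iff_ualg_iso)
qed

lemma ualg_isomorphic_sym:
  assumes "ualgebra ar A" "ualg_isomorphic ar A B"
  shows "ualg_isomorphic ar B A"
  using assms inv_ualg_iso by (metis ualg_isomorphic_iff_ualg_iso)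

lemma ualg_isomorphic_trans:
  assumes "ualgebra ar A" "ualg_isomorphic ar A B" "ualg_isomorphic ar B D"
  shows "ualg_isomorphic ar A D"
proof -
  obtain h g where "h \<in> ualg_iso ar A B" "g \<in> ualg_iso ar B D"
    using assms(2,3) by (auto simp: ualg_isomorphic_iff_ualg_iso)
  then have "compose (carrier A) g h \<in> ualg_iso ar A D"
    using ualg_hom_comp[OF assms(1), of h B g D]
      bij_betw_compose[of h "carrier A" "carrier B" g "carrier D"]
    by (simp add: ualg_iso_def)
  then show ?thesis by (auto simp: ualg_isomorphic_iff_ualg_iso)
qed

lemma ualg_isomorphic_cong:
  assumes "ualgebra ar X" "ualgebra ar Y" "ualgebra ar B" "ualgebra ar B'"
    and "ualg_isomorphic ar X Y" "ualg_isomorphic ar B' B"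
  shows "ualg_isomorphic ar X B \<longleftrightarrow> ualg_isomorphic ar Y B'"
  using assms by (meson ualg_isomorphic_sym ualg_isomorphic_trans)

section \<open>Transport of subalgebras along an isomorphism\<close>

text \<open>
  The operations of a subalgebra are inherited, hence inclusion between
  subalgebras of a common algebra can be tested on carriers.
\<close>

lemma subalg_iff_carrier_subset:
  assumes "subalg ar X C" "subalg ar Y C"
  shows "subalg ar X Y \<longleftrightarrow> carrier X \<subseteq> carrier Y"
proof
  assume XY: "carrier X \<subseteq> carrier Y"
  then have "args ar (carrier X) f \<subseteq> args ar (carrier Y) f" for f
    by (auto simp: args_def)
  then show "subalg ar X Y"
    using assms XY by (auto simp: subalg_def subset_iff)
qed (simp add: subalg_def)

text \<open>
  The operations are restricted from \<open>C'\<close> instead of being carried over from \<open>Y\<close> by \<open>h\<close>. For an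
  automorphism \<open>h\<close> of \<open>C\<close> this makes the image literally the value of the action of \<open>h\<close> on \<open>Y\<close>.
\<close>

definition image_alg ::
  "('f \<Rightarrow> nat) \<Rightarrow> ('f, 'b) ualg \<Rightarrow> ('a \<Rightarrow> 'b) \<Rightarrow> ('f, 'a) ualg \<Rightarrow> ('f, 'b) ualg" where
  "image_alg ar C' h Y = induced_alg ar C' (h ` carrier Y)"

lemma carrier_image_alg [simp]: "carrier (image_alg ar C' h Y) = h ` carrier Y"
  by (simp add: image_alg_def induced_alg_def)

text \<open>
  The image is closed under the operations of \<open>C'\<close> because an argument list over \<open>h(Y)\<close> lifts to one
  over \<open>Y\<close>; the same computation shows that \<open>h\<close> restricts to an isomorphism.
\<close>

lemma image_alg_subalg_iso:
  assumes C': "ualgebra ar C'" and h: "h \<in> ualg_iso ar C C'" and Y: "subalg ar Y C"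
  shows "subalg ar (image_alg ar C' h Y) C'"
    and "h \<in> ualg_iso ar Y (image_alg ar C' h Y)"
proof -
  let ?Z = "image_alg ar C' h Y"
  have hom: "h \<in> ualg_hom ar C C'" and bij: "bij_betw h (carrier C) (carrier C')"
    using h by (auto simp: ualg_iso_def)
  have Yalg: "ualgebra ar Y" and YC: "carrier Y \<subseteq> carrier C"
    using Y by (auto simp: subalg_def)
  have op: "oper C' f (map h ys) = h (oper Y f ys)" if "ys \<in> args ar (carrier Y) f" for f ys
  proof -
    have "ys \<in> args ar (carrier C) f" using that YC by (auto simp: args_def)
    then show ?thesis using that hom Y by (auto simp: ualg_hom_def subalg_def)
  qed
  have operZ: "oper ?Z f = restrict (oper C' f) (args ar (h ` carrier Y) f)" for f
    by (simp add: image_alg_def induced_alg_def)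
  have "ualgebra ar ?Z"
    unfolding ualgebra_def
  proof (intro allI PiE_I)
    fix f xs assume xs: "xs \<in> args ar (carrier ?Z) f"
    then obtain ys where "ys \<in> args ar (carrier Y) f" "xs = map h ys"
      using args_image[of xs ar h "carrier Y" f] by auto
    then show "oper ?Z f xs \<in> carrier ?Z"
      using op xs ualgebra_closed[OF Yalg] by (simp add: operZ)
  qed (simp add: operZ)
  moreover have "h ` carrier Y \<subseteq> carrier C'"
    using bij YC by (auto simp: bij_betw_def)
  ultimately show "subalg ar ?Z C'"
    using C' by (simp add: subalg_def operZ)
  have "map h ys \<in> args ar (h ` carrier Y) f" if "ys \<in> args ar (carrier Y) f" for f ys
    using args_map[OF subset_refl that] .
  then have "h \<in> ualg_hom ar Y ?Z"
    using op by (auto simp: ualg_hom_def operZ)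
  moreover have "bij_betw h (carrier Y) (carrier ?Z)"
    using bij YC by (auto simp: bij_betw_def intro: inj_on_subset)
  ultimately show "h \<in> ualg_iso ar Y ?Z" by (simp add: ualg_iso_def)
qed

lemma image_alg_isomorphic:
  assumes "ualgebra ar C'" "h \<in> ualg_iso ar C C'" "subalg ar Y C"
  shows "ualg_isomorphic ar Y (image_alg ar C' h Y)"
  using image_alg_subalg_iso(2)[OF assms] by (auto simp: ualg_isomorphic_iff_ualg_iso)

lemma image_alg_mono_iff:
  assumes "ualgebra ar C'" "h \<in> ualg_iso ar C C'" "subalg ar X C" "subalg ar Y C"
  shows "subalg ar (image_alg ar C' h X) (image_alg ar C' h Y) \<longleftrightarrow> subalg ar X Y"
proof -
  have "inj_on h (carrier C)" "carrier X \<subseteq> carrier C" "carrier Y \<subseteq> carrier C"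
    using assms by (auto simp: ualg_iso_def bij_betw_def subalg_def)
  then have "h x \<in> h ` carrier Y \<longleftrightarrow> x \<in> carrier Y" if "x \<in> carrier X" for x
    using that by (intro inj_on_image_mem_iff[of h "carrier C"]) auto
  then have "h ` carrier X \<subseteq> h ` carrier Y \<longleftrightarrow> carrier X \<subseteq> carrier Y"
    by blast
  then show ?thesis
    using subalg_iff_carrier_subset[OF assms(3,4)]
      subalg_iff_carrier_subset[OF image_alg_subalg_iso(1)[OF assms(1-3)]
        image_alg_subalg_iso(1)[OF assms(1,2,4)]]
    by simp
qed

lemma image_alg_inverse:
  assumes "subalg ar Y C" "\<And>x. x \<in> carrier Y \<Longrightarrow> g (h x) = x"
  shows "image_alg ar C g (image_alg ar C' h Y) = Y"
proof -
  have "g ` h ` carrier Y = carrier Y"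
    using assms(2) by (force simp: image_iff)
  then show ?thesis
    using assms(1) by (simp add: image_alg_def[of ar C] subalg_induced)
qed

lemma bij_betw_image_alg:
  assumes C: "ualgebra ar C" and C': "ualgebra ar C'" and h: "h \<in> ualg_iso ar C C'"
  shows "bij_betw (image_alg ar C' h) {Y. subalg ar Y C} {Z. subalg ar Z C'}"
proof -
  let ?g = "restrict (inv_into (carrier C) h) (carrier C')"
  have g: "?g \<in> ualg_iso ar C' C"
    using C h by (rule inv_ualg_iso)
  have bij: "bij_betw h (carrier C) (carrier C')"
    using h by (simp add: ualg_iso_def)
  have gh: "?g (h x) = x" if "x \<in> carrier C" for x
    using that bij by (auto simp: bij_betw_def)
  have hg: "h (?g z) = z" if "z \<in> carrier C'" for z
    using that bij by (simp add: bij_betw_inv_into_right)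
  show ?thesis
  proof (rule bij_betw_byWitness[where f' = "image_alg ar C ?g"])
    show "\<forall>Y\<in>{Y. subalg ar Y C}. image_alg ar C ?g (image_alg ar C' h Y) = Y"
    proof
      fix Y assume "Y \<in> {Y. subalg ar Y C}"
      then have Y: "subalg ar Y C" "carrier Y \<subseteq> carrier C" by (auto simp: subalg_def)
      show "image_alg ar C ?g (image_alg ar C' h Y) = Y"
        by (rule image_alg_inverse[OF Y(1)], rule gh) (use Y(2) in blast)
    qed
    show "\<forall>Z\<in>{Z. subalg ar Z C'}. image_alg ar C' h (image_alg ar C ?g Z) = Z"
    proof
      fix Z assume "Z \<in> {Z. subalg ar Z C'}"
      then have Z: "subalg ar Z C'" "carrier Z \<subseteq> carrier C'" by (auto simp: subalg_def)
      show "image_alg ar C' h (image_alg ar C ?g Z) = Z"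
        by (rule image_alg_inverse[OF Z(1)], rule hg) (use Z(2) in blast)
    qed
    show "image_alg ar C' h ` {Y. subalg ar Y C} \<subseteq> {Z. subalg ar Z C'}"
      using image_alg_subalg_iso(1)[OF C' h] by blast
    show "image_alg ar C ?g ` {Z. subalg ar Z C'} \<subseteq> {Y. subalg ar Y C}"
      using image_alg_subalg_iso(1)[OF C g] by blast
  qed
qed

lemma card_subalgs_transport:
  assumes "ualgebra ar C" "ualgebra ar C'" "h \<in> ualg_iso ar C C'"
    and PQ: "\<And>Y. subalg ar Y C \<Longrightarrow> P Y \<longleftrightarrow> Q (image_alg ar C' h Y)"
  shows "card {Y. subalg ar Y C \<and> P Y} = card {Z. subalg ar Z C' \<and> Q Z}"
proof (rule bij_betw_same_card, rule bij_betw_subset[OF bij_betw_image_alg[OF assms(1-3)]])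
  have "image_alg ar C' h ` {Y. subalg ar Y C} = {Z. subalg ar Z C'}"
    using bij_betw_image_alg[OF assms(1-3)] by (rule bij_betw_imp_surj_on)
  moreover have "image_alg ar C' h ` {Y. subalg ar Y C \<and> P Y} =
      {Z \<in> image_alg ar C' h ` {Y. subalg ar Y C}. Q Z}"
    using PQ by auto
  ultimately show "image_alg ar C' h ` {Y. subalg ar Y C \<and> P Y} = {Z. subalg ar Z C' \<and> Q Z}"
    by simp
qed blast

section \<open>Orbits of the automorphism group\<close>

lemma Aut_carrier_ualg_iso: "h \<in> carrier (Aut ar C) \<Longrightarrow> h \<in> ualg_iso ar C C"
  by (simp add: Aut_def ualg_iso_def Bij_def)

lemma mem_iso_subalgs_self: "subalg ar X C \<Longrightarrow> X \<in> iso_subalgs ar C X"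
  by (simp add: iso_subalgs_def ualg_isomorphic_refl)

lemma mem_Aut_orbit_iff:
  assumes "subalg ar X C"
  shows "Y \<in> Aut_orbit ar C X \<longleftrightarrow> (\<exists>h \<in> carrier (Aut ar C). Y = image_alg ar C h X)"
  using mem_iso_subalgs_self[OF assms]
  by (auto simp: Aut_orbit_def orbit_def Aut_action_def image_alg_def)

lemma Aut_orbit_subset_iso_subalgs:
  assumes "subalg ar X C"
  shows "Aut_orbit ar C X \<subseteq> iso_subalgs ar C X"
proof -
  have C: "ualgebra ar C" using assms by (simp add: subalg_def)
  show ?thesis
    using induced_alg_image[OF C _ mem_iso_subalgs_self[OF assms]]
    by (auto simp: mem_Aut_orbit_iff[OF assms] image_alg_def)
qed

text \<open>
  Both orbits are formed for actions whose underlying sets consist of the copies of \<open>X\<close> and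
  of the copies of \<open>Y\<close>. These sets coincide as \<open>X\<close> and \<open>Y\<close> are isomorphic, so there is a single
  group action, whose orbits are the classes of an equivalence relation.
\<close>

lemma Aut_orbit_eq:
  assumes X: "subalg ar X C" and Y: "Y \<in> Aut_orbit ar C X"
  shows "Aut_orbit ar C Y = Aut_orbit ar C X"
proof -
  have C: "ualgebra ar C" and Xalg: "ualgebra ar X" using X by (auto simp: subalg_def)
  have YE: "Y \<in> iso_subalgs ar C X"
    using Aut_orbit_subset_iso_subalgs[OF X] Y by blast
  then have YC: "subalg ar Y C" and iso: "ualg_isomorphic ar Y X"
    by (auto simp: iso_subalgs_def)
  have Yalg: "ualgebra ar Y" using YC by (simp add: subalg_def)
  have "iso_subalgs ar C Y = iso_subalgs ar C X"
    using ualg_isomorphic_cong[OF _ _ Xalg Yalg ualg_isomorphic_refl iso]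
    by (auto simp: iso_subalgs_def subalg_def)
  then have act: "Aut_action ar C Y = Aut_action ar C X"
    by (simp add: Aut_action_def fun_eq_iff)
  interpret group_action "Aut ar C" "iso_subalgs ar C X" "Aut_action ar C X"
    using C by (rule group_action_Aut)
  let ?orb = "orbit (Aut ar C) (Aut_action ar C X)"
  have XE: "X \<in> iso_subalgs ar C X" using X by (rule mem_iso_subalgs_self)
  have YX: "Y \<in> ?orb X" using Y by (simp add: Aut_orbit_def)
  have sub: "?orb V \<subseteq> iso_subalgs ar C X" if "V \<in> iso_subalgs ar C X" for V
    using element_image[OF _ that] by (auto simp: orbit_def)
  have "?orb Y = ?orb X"
    using orbit_trans[OF XE YE _ YX] orbit_trans[OF YE XE _ orbit_sym[OF XE YE YX]]
      sub[OF XE] sub[OF YE] by blast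
  then show ?thesis by (simp add: Aut_orbit_def act)
qed

text \<open>
  \<open>Y\<close> and \<open>h(Y)\<close> have the same orbit and both lie in it; as orbits are equal or disjoint,
  either both or neither of them lie in the orbit of \<open>X\<close>.
\<close>

lemma image_alg_mem_Aut_orbit_iff:
  assumes X: "subalg ar X C" and Y: "subalg ar Y C" and h: "h \<in> carrier (Aut ar C)"
  shows "image_alg ar C h Y \<in> Aut_orbit ar C X \<longleftrightarrow> Y \<in> Aut_orbit ar C X"
proof -
  have C: "ualgebra ar C" using X by (simp add: subalg_def)
  have hY: "image_alg ar C h Y \<in> Aut_orbit ar C Y"
    using h by (auto simp: mem_Aut_orbit_iff[OF Y])
  have "Y \<in> Aut_orbit ar C Y"
    using group_action.orbit_refl[OF group_action_Aut[OF C] mem_iso_subalgs_self[OF Y]]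
    by (simp add: Aut_orbit_def)
  then show ?thesis
    using hY Aut_orbit_eq[OF Y hY] Aut_orbit_eq[OF X] by metis
qed

section \<open>Invariance of the Hasse constants\<close>

lemma hasse_isomorphic:
  fixes C :: "('f, 'c) ualg" and C' :: "('f, 'd) ualg"
    and B :: "('f, 'b) ualg" and B' :: "('f, 'e) ualg"
  assumes "ualgebra ar C" "ualgebra ar C'" "ualgebra ar B" "ualgebra ar B'"
    and "ualg_isomorphic ar C C'" "ualg_isomorphic ar B' B"
  shows "hasse ar C B = hasse ar C' B'"
proof -
  obtain h where h: "h \<in> ualg_iso ar C C'"
    using assms(5) by (auto simp: ualg_isomorphic_iff_ualg_iso)
  show ?thesis
    unfolding hasse_def
  proof (rule card_subalgs_transport[OF assms(1,2) h])
    fix Y assume Y: "subalg ar Y C"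
    show "ualg_isomorphic ar Y B \<longleftrightarrow> ualg_isomorphic ar (image_alg ar C' h Y) B'"
      using Y image_alg_subalg_iso(1)[OF assms(2) h Y]
      by (intro ualg_isomorphic_cong image_alg_isomorphic[OF assms(2) h] assms)
        (auto simp: subalg_def)
  qed
qed

lemma hasse_over_orbit:
  fixes A C :: "('f, 'c) ualg" and B :: "('f, 'b) ualg" and B' :: "('f, 'e) ualg"
  assumes A: "subalg ar A C" and A': "A' \<in> Aut_orbit ar C A"
    and B: "ualgebra ar B" "ualgebra ar B'" "ualg_isomorphic ar B' B"
  shows "hasse_over ar C A B = hasse_over ar C A' B'"
proof -
  have C: "ualgebra ar C" using A by (simp add: subalg_def)
  obtain h where "h \<in> carrier (Aut ar C)" and A'_eq: "A' = image_alg ar C h A"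
    using A' by (auto simp: mem_Aut_orbit_iff[OF A])
  then have h: "h \<in> ualg_iso ar C C" by (simp add: Aut_carrier_ualg_iso)
  show ?thesis
    unfolding hasse_over_def A'_eq
  proof (rule card_subalgs_transport[OF C C h])
    fix Y assume Y: "subalg ar Y C"
    have "ualg_isomorphic ar Y B \<longleftrightarrow> ualg_isomorphic ar (image_alg ar C h Y) B'"
      using Y image_alg_subalg_iso(1)[OF C h Y]
      by (intro ualg_isomorphic_cong image_alg_isomorphic[OF C h] B) (auto simp: subalg_def)
    then show "subalg ar A Y \<and> ualg_isomorphic ar Y B \<longleftrightarrow>
        subalg ar (image_alg ar C h A) (image_alg ar C h Y) \<and>
        ualg_isomorphic ar (image_alg ar C h Y) B'"
      by (simp add: image_alg_mono_iff[OF C h A Y])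
  qed
qed

lemma hasse_orbit_orbit:
  assumes A: "subalg ar A C" and A': "A' \<in> Aut_orbit ar C A"
    and D: "subalg ar D C" and D': "D' \<in> Aut_orbit ar C D"
  shows "hasse_orbit ar C A D = hasse_orbit ar C A' D'"
proof -
  have C: "ualgebra ar C" using A by (simp add: subalg_def)
  obtain h where h: "h \<in> carrier (Aut ar C)" and A'_eq: "A' = image_alg ar C h A"
    using A' by (auto simp: mem_Aut_orbit_iff[OF A])
  then have iso: "h \<in> ualg_iso ar C C" by (simp add: Aut_carrier_ualg_iso)
  show ?thesis
    unfolding hasse_orbit_def A'_eq Aut_orbit_eq[OF D D']
    by (rule card_subalgs_transport[OF C C iso])
      (simp add: image_alg_mono_iff[OF C iso A] image_alg_mem_Aut_orbit_iff[OF D _ h])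
qed

theorem lemma2p1:
  fixes ar :: "'f \<Rightarrow> nat"
    and A C :: "('f, 'c) ualg" and B :: "('f, 'b) ualg"
  assumes "finite_ualgebra ar A" and "finite_ualgebra ar B" and "finite_ualgebra ar C"
    and "subalg ar A C"
  shows "(\<forall>(B' :: ('f, 'b1) ualg) (C' :: ('f, 'c1) ualg).
            finite_ualgebra ar B' \<and> finite_ualgebra ar C' \<and>
            ualg_isomorphic ar B' B \<and> ualg_isomorphic ar C' C \<longrightarrow>
            hasse ar C B = hasse ar C' B')
       \<and> (\<forall>A' (B' :: ('f, 'b1) ualg).
            A' \<in> Aut_orbit ar C A \<and> finite_ualgebra ar B' \<and> ualg_isomorphic ar B' B \<longrightarrow>
            hasse_over ar C A B = hasse_over ar C A' B')
       \<and> (\<forall>A' (D :: ('f, 'c) ualg) D'.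
            A' \<in> Aut_orbit ar C A \<and> subalg ar D C \<and> D' \<in> Aut_orbit ar C D \<longrightarrow>
            hasse_orbit ar C A D = hasse_orbit ar C A' D')"
proof -
  have B: "ualgebra ar B" and C: "ualgebra ar C"
    using assms by (auto simp: finite_ualgebra_def)
  show ?thesis
  proof (intro conjI allI impI; elim conjE)
    fix B' :: "('f, 'b1) ualg" and C' :: "('f, 'c1) ualg"
    assume "finite_ualgebra ar B'" "finite_ualgebra ar C'"
      and iso: "ualg_isomorphic ar B' B" "ualg_isomorphic ar C' C"
    then have B': "ualgebra ar B'" and C': "ualgebra ar C'"
      by (auto simp: finite_ualgebra_def)
    show "hasse ar C B = hasse ar C' B'"
      by (rule hasse_isomorphic[OF C C' B B' ualg_isomorphic_sym[OF C' iso(2)] iso(1)])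
  next
    fix A' and B' :: "('f, 'b1) ualg"
    assume "A' \<in> Aut_orbit ar C A" "finite_ualgebra ar B'" "ualg_isomorphic ar B' B"
    then show "hasse_over ar C A B = hasse_over ar C A' B'"
      by (intro hasse_over_orbit[OF assms(4)] B) (auto simp: finite_ualgebra_def)
  next
    fix A' D D'
    assume "A' \<in> Aut_orbit ar C A" "subalg ar D C" "D' \<in> Aut_orbit ar C D"
    then show "hasse_orbit ar C A D = hasse_orbit ar C A' D'"
      by (rule hasse_orbit_orbit[OF assms(4)])
  qed
qed

end
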